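(* Let $A_0,A_1,A_2$ be three non-collinear points in $\mathbb{R}^n$, let $G=\frac{1}{3}(A_0+A_1+A_2)$ be the centroid of the triangle $\triangle A_0A_1A_2$, and let $H$ be its orthocenter (in the plane of the triangle). For $\{i,j,k\}=\{0,1,2\}$ let $M_i=\frac{1}{2}(A_j+A_k)$. Let $P\in\mathbb{R}^n$ be a point equidistant from $A_0,A_1,A_2$, let $r=\|P-A_0\|=\|P-A_1\|=\|P-A_2\|$, and let $\mathcal{S}$ be the sphere in $\mathbb{R}^n$ with center $P$ and radius $r$. For $i=0,1,2$ let $\mathcal{S}_i$ be the image of $\mathcal{S}$ under the point reflection with respect to $M_i$. Put $H_P=A_0+A_1+A_2-2P$. Then the spheres $\mathcal{S}_0,\mathcal{S}_1,\mathcal{S}_2$ concur in the points $H$ and $H_P$, i.e. both $H$ and $H_P$ belong to $\mathcal{S}_0\cap\mathcal{S}_1\cap\mathcal{S}_2$. Furthermore, the following hold. 1. If $B_i$ denotes the center of $\mathcal{S}_i$ ($i=0,1,2$), then the triangles $\triangle A_0A_1A_2$ and $\triangle B_0B_1B_2$ are symmetric with center of symmetry $Q_P=\frac{1}{2}(A_0+A_1+A_2-P)$, i.e. the point reflection with respect to $Q_P$ maps $A_i$ to $B_i$ for $i=0,1,2$. 2. The points $P$, $G$, $H_P$ are collinear, with $G$ between $P$ and $H_P$, and $2\,\|G-P\|=\|H_P-G\|$. 3. Let $N_i=\frac{1}{2}(B_j+B_k)$ for $\{i,j,k\}=\{0,1,2\}$ be the midpoints of the sides of $\triangle B_0B_1B_2$,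 and let $\mathcal{S}_M$ be the sphere with center $Q_P$ and radius $r/2$. Then $\mathcal{S}_M$ passes through $M_0,M_1,M_2,N_0,N_1,N_2$. It also passes through the midpoints of the segments joining $H_P$ with the points of $\mathcal{S}$, and through the midpoints of the segments joining $P$ with the points of the sphere $\mathcal{S}_H$ with center $H_P$ and radius $r$. 4. The points $P,Q_P,G,H_P$ form a harmonic range, with $$\frac{\|G-P\|}{\|Q_P-G\|}=\frac{\|H_P-P\|}{\|Q_P-H_P\|}=2.$$
   Context: $\mathbb{R}^n$ carries the Euclidean norm $\|\cdot\|$. The point reflection with respect to a point $C$ is the map $X\mapsto 2C-X$. The circumcenter $O$ of $\triangle A_0A_1A_2$ is the unique point of the plane (affine hull) of $A_0,A_1,A_2$ equidistant from them; the orthocenter $H$ is the common point of the altitudes of the triangle in that plane, and $H=A_0+A_1+A_2-2O$. To say that $P,Q_P,G,H_P$ form a harmonic range means that they are collinear and that $G$ and $H_P$ divide the segment $PQ_P$ internally and externally, respectively, in the same ratio.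
   Formalization: In item 4 the harmonic range and the quotients are claimed only for P ≠ G; if the triangle is equilateral with center P, then P = Q_P = G = H_P and the ratios are 0/0. Collinearity and the equalities ‖G−P‖ = 2‖Q_P−G‖, ‖H_P−P‖ = 2‖Q_P−H_P‖ are proved always. *)

theory Defs
  imports "HOL-Analysis.Analysis"
begin

definition point_reflection :: "'a::real_vector \<Rightarrow> 'a \<Rightarrow> 'a" where
  "point_reflection C X = 2 *\<^sub>R C - X"

(* The altitude through A, taken within the plane of the triangle A B C. *)
definition altitude :: "'a::real_inner \<Rightarrow> 'a \<Rightarrow> 'a \<Rightarrow> 'a set" where
  "altitude A B C = {X \<in> affine hull {A, B, C}. (X - A) \<bullet> (B - C) = 0}"

definition orthocenter :: "'a::real_inner \<Rightarrow> 'a \<Rightarrow> 'a \<Rightarrow> 'a" where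
  "orthocenter A B C = (THE H. H \<in> altitude A B C \<inter> altitude B C A \<inter> altitude C A B)"

definition sphere_center :: "'a::metric_space set \<Rightarrow> 'a" where
  "sphere_center S = (THE C. \<exists>\<rho>>0. S = sphere C \<rho>)"

definition divides_internally :: "'a::euclidean_space \<Rightarrow> 'a \<Rightarrow> 'a \<Rightarrow> real \<Rightarrow> bool" where
  "divides_internally X A B k \<longleftrightarrow> X \<in> open_segment A B \<and> norm (X - A) / norm (B - X) = k"

definition divides_externally :: "'a::euclidean_space \<Rightarrow> 'a \<Rightarrow> 'a \<Rightarrow> real \<Rightarrow> bool" where
  "divides_externally X A B k \<longleftrightarrow>
     A \<noteq> B \<and> X \<in> affine hull {A, B} - closed_segment A B \<and> norm (X - A) / norm (B - X) = k"

(* Nondegenerate by definition: the open segment must contain C, so A and B are distinct. *)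
definition harmonic_range :: "'a::euclidean_space \<Rightarrow> 'a \<Rightarrow> 'a \<Rightarrow> 'a \<Rightarrow> bool" where
  "harmonic_range A B C D \<longleftrightarrow>
     collinear {A, B, C, D} \<and> (\<exists>k. divides_internally C A B k \<and> divides_externally D A B k)"

end

theory Submission
  imports Defs
begin

text \<open>
  Let \<open>O\<close> be the orthogonal projection of \<open>P\<close> onto the plane of the triangle and \<open>W = P - O\<close>. Then
  \<open>O\<close> is the circumcenter, and \<open>H = A\<^sub>0 + A\<^sub>1 + A\<^sub>2 - 2 O\<close>. The sphere \<open>S\<^sub>i\<close> has center
  \<open>A\<^sub>j + A\<^sub>k - P\<close>, from which \<open>H\<close> is displaced by \<open>(A\<^sub>i - O) + W\<close>, the mirror image in the plane
  of \<open>(A\<^sub>i - O) - W = A\<^sub>i - P\<close>; hence its length is \<open>r\<close>. Everything else is affine: with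
  \<open>D = G - P\<close>, the points \<open>P\<close>, \<open>G\<close>, \<open>Q\<^sub>P\<close>, \<open>H\<^sub>P\<close> sit at parameters \<open>0, 1, 3/2, 3\<close> on a line with
  direction \<open>D\<close>.
\<close>

section \<open>Spheres: uniqueness of the center, images under point reflections\<close>

lemma sphere_center_sphere:
  fixes C :: "'a::real_normed_vector"
  assumes "\<rho> > 0"
  shows "sphere_center (sphere C \<rho>) = C"
  unfolding sphere_center_def
proof (rule the_equality)
  show "\<exists>\<sigma>>0. sphere C \<rho> = sphere C \<sigma>"
    using assms by blast
next
  fix D assume "\<exists>\<sigma>>0. sphere C \<rho> = sphere D \<sigma>"
  then obtain \<sigma> where "\<sigma> > 0" and eq: "sphere C \<rho> = sphere D \<sigma>"
    by blast
  show "D = C"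
  proof (rule ccontr)
    assume "D \<noteq> C"
    define \<delta> where "\<delta> = norm (C - D)"
    define E where "E = (1 / \<delta>) *\<^sub>R (C - D)"
    have "\<delta> > 0" and E: "norm E = 1" "C - D = \<delta> *\<^sub>R E"
      using \<open>D \<noteq> C\<close> by (simp_all add: \<delta>_def E_def)
    \<comment> \<open>The line through the two supposed centers meets the sphere in these two
      points. Their distances from \<open>D\<close> are the absolute values of
      \<open>\<delta> + \<rho>\<close> and \<open>\<delta> - \<rho>\<close>, which cannot agree for
      positive \<open>\<delta>\<close> and \<open>\<rho>\<close>.\<close>
    have "C + \<rho> *\<^sub>R E \<in> sphere C \<rho>" "C - \<rho> *\<^sub>R E \<in> sphere C \<rho>"
      using assms E by (simp_all add: dist_norm)
    then have "norm (C + \<rho> *\<^sub>R E - D) = \<sigma>" "norm (C - \<rho> *\<^sub>R E - D) = \<sigma>"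
      by (simp_all add: eq dist_norm norm_minus_commute)
    moreover have "C + \<rho> *\<^sub>R E - D = (\<delta> + \<rho>) *\<^sub>R E" "C - \<rho> *\<^sub>R E - D = (\<delta> - \<rho>) *\<^sub>R E"
      using E(2) by (simp_all add: algebra_simps)
    ultimately have "\<bar>\<delta> + \<rho>\<bar> = \<bar>\<delta> - \<rho>\<bar>"
      using E(1) by simp
    then show False
      using \<open>\<delta> > 0\<close> assms by linarith
  qed
qed

lemma point_reflection_image_sphere:
  fixes C P :: "'a::real_normed_vector"
  shows "point_reflection C ` sphere P r = sphere (2 *\<^sub>R C - P) r"
proof -
  have dist: "dist P (2 *\<^sub>R C - X) = dist (2 *\<^sub>R C - P) X" for X
  proof -
    have "P - (2 *\<^sub>R C - X) = - (2 *\<^sub>R C - P - X)"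
      by simp
    then show ?thesis
      unfolding dist_norm by (metis norm_minus_cancel)
  qed
  \<comment> \<open>A point reflection is an involution, so its images are also its
    preimages.\<close>
  have "X \<in> point_reflection C ` sphere P r \<longleftrightarrow> 2 *\<^sub>R C - X \<in> sphere P r" for X
    by (metis (no_types, lifting) diff_diff_eq2 add_diff_cancel_left' imageE image_eqI point_reflection_def)
  then show ?thesis
    unfolding set_eq_iff by (simp add: dist)
qed

section \<open>The orthocenter and its distances from the reflected centers\<close>

lemma affine_hull_triangle:
  fixes A B C :: "'a::real_vector"
  shows "X \<in> affine hull {A, B, C} \<longleftrightarrow> X - A \<in> span {B - A, C - A}"
proof -
  have "affine hull {A, B, C} = (+) A ` span {B - A, C - A}"
    using affine_hull_insert_span_gen[of A "{B, C}"] by simp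
  moreover have "X \<in> (+) A ` V \<longleftrightarrow> X - A \<in> V" for V
    by (metis add_diff_cancel_left' diff_add_cancel add.commute imageE image_eqI)
  ultimately show ?thesis
    by simp
qed

text \<open>Two common points of the altitudes differ by a vector that lies in the direction space
  of the plane and is orthogonal to the sides, hence to itself.\<close>

lemma orthocenter_eqI:
  fixes A B C X :: "'a::real_inner"
  assumes "X \<in> affine hull {A, B, C}"
    and "(X - A) \<bullet> (B - C) = 0" "(X - B) \<bullet> (C - A) = 0" "(X - C) \<bullet> (A - B) = 0"
  shows "orthocenter A B C = X"
  unfolding orthocenter_def
proof (rule the_equality)
  show "X \<in> altitude A B C \<inter> altitude B C A \<inter> altitude C A B"
    using assms by (simp add: altitude_def insert_commute)
next
  fix Y assume Y: "Y \<in> altitude A B C \<inter> altitude B C A \<inter> altitude C A B"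
  define D where "D = Y - X"
  have "Y - A \<in> span {B - A, C - A}" "X - A \<in> span {B - A, C - A}"
    using Y assms(1) by (simp_all add: altitude_def affine_hull_triangle)
  then have "D \<in> span {B - A, C - A}"
    using span_diff[of "Y - A" _ "X - A"] by (simp add: D_def)
  moreover have "D \<bullet> (B - A) = 0" "D \<bullet> (C - A) = 0"
    using Y assms(2-) by (auto simp: D_def altitude_def inner_diff_left inner_diff_right)
  then have "\<And>Z. Z \<in> {B - A, C - A} \<Longrightarrow> orthogonal D Z"
    by (auto simp: orthogonal_def)
  ultimately have "orthogonal D D"
    using orthogonal_to_span by blast
  then show "Y = X"
    by (simp add: orthogonal_self D_def)
qed

text \<open>Since \<open>B + C - P\<close> is the reflection of \<open>P\<close> in the midpoint of
  \<open>B\<close> and \<open>C\<close>, the three equations place the orthocenter on the three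
  reflected spheres.\<close>

lemma orthocenter_dist:
  fixes A B C P :: "'a::euclidean_space"
  assumes "norm (P - A) = r" "norm (P - B) = r" "norm (P - C) = r"
  shows "norm (orthocenter A B C - (B + C - P)) = r"
    and "norm (orthocenter A B C - (C + A - P)) = r"
    and "norm (orthocenter A B C - (A + B - P)) = r"
proof -
  \<comment> \<open>\<open>V\<close> is the component of \<open>P - A\<close> along the plane and
    \<open>W\<close> the normal one; the projection of \<open>P\<close> is thus
    \<open>A + V\<close>, named \<open>Q\<close> below.\<close>
  obtain V W where V: "V \<in> span {B - A, C - A}"
    and W: "\<And>Z. Z \<in> span {B - A, C - A} \<Longrightarrow> orthogonal W Z"
    and "P - A = V + W"
    using orthogonal_subspace_decomp_exists by metis
  define Q where "Q = A + V" \<comment> \<open>the circumcenter\<close>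
  then have PQ: "P - Q = W"
    using \<open>P - A = V + W\<close> by (simp add: algebra_simps)
  have "W \<bullet> (B - A) = 0" "W \<bullet> (C - A) = 0" "W \<bullet> V = 0"
    using W V by (auto simp: orthogonal_def span_base)
  then have W0: "W \<bullet> (A - Q) = 0" "W \<bullet> (B - Q) = 0" "W \<bullet> (C - Q) = 0"
    by (auto simp: Q_def inner_diff_right inner_add_right)
  \<comment> \<open>Adding \<open>2 *\<^sub>R W\<close> turns \<open>Y - W\<close> into
    \<open>Y + W\<close>; as \<open>W\<close> is orthogonal to \<open>Y\<close>, both have the same
    norm by Pythagoras.\<close>
  have norm_W: "norm (X - P + 2 *\<^sub>R W) = norm (X - P)" if "W \<bullet> (X - Q) = 0" for X
  proof -
    define Y where "Y = X - Q"
    have "X - P = Y - W" "X - P + 2 *\<^sub>R W = Y + W"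
      using PQ by (auto simp: Y_def algebra_simps scaleR_2)
    moreover have "W \<bullet> Y = 0"
      using that by (simp add: Y_def)
    ultimately show ?thesis
      by (simp add: norm_eq inner_simps inner_commute)
  qed
  define H where "H = A + B + C - 2 *\<^sub>R Q"
  \<comment> \<open>The product is the difference of the squared distances of \<open>X\<close> and
    \<open>Y\<close> from \<open>Q\<close>, which agree because their distances from
    \<open>P\<close> do. Applied to two vertices it is an altitude condition, as
    \<open>H - A\<close> is \<open>(B - Q) + (C - Q)\<close>.\<close>
  have perp: "(X - Q + (Y - Q)) \<bullet> (X - Y) = 0"
    if "norm (P - X) = norm (P - Y)" "W \<bullet> (X - Q) = 0" "W \<bullet> (Y - Q) = 0" for X Y
  proof -
    have "norm (W - (X - Q)) = norm (W - (Y - Q))"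
      using that(1) by (simp flip: PQ)
    then have "(X - Q) \<bullet> (X - Q) = (Y - Q) \<bullet> (Y - Q)"
      using that(2,3) inner_commute[of "X - Q" W] inner_commute[of "Y - Q" W]
      unfolding norm_eq inner_diff_left[of W] inner_diff_right[of _ W] by linarith
    moreover have "(X - Q + (Y - Q)) \<bullet> (X - Q - (Y - Q)) = (X - Q) \<bullet> (X - Q) - (Y - Q) \<bullet> (Y - Q)"
      unfolding inner_add_left inner_diff_right[of _ "X - Q" "Y - Q"] by (simp add: inner_commute)
    ultimately show ?thesis
      by simp
  qed
  have "orthocenter A B C = H"
  proof (rule orthocenter_eqI)
    have "H - A = (B - A) + (C - A) - 2 *\<^sub>R V"
      by (simp add: H_def Q_def algebra_simps scaleR_2)
    moreover have "(B - A) + (C - A) - 2 *\<^sub>R V \<in> span {B - A, C - A}"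
      by (rule span_diff[OF span_add span_scale[OF V]]; simp add: span_base)
    ultimately show "H \<in> affine hull {A, B, C}"
      by (simp only: affine_hull_triangle)
  next
    have "H - A = B - Q + (C - Q)" "H - B = C - Q + (A - Q)" "H - C = A - Q + (B - Q)"
      by (simp_all add: H_def algebra_simps scaleR_2)
    then show "(H - A) \<bullet> (B - C) = 0" "(H - B) \<bullet> (C - A) = 0" "(H - C) \<bullet> (A - B) = 0"
      using perp assms W0 by simp_all
  qed
  moreover have "H - (B + C - P) = A - P + 2 *\<^sub>R W" "H - (C + A - P) = B - P + 2 *\<^sub>R W"
    "H - (A + B - P) = C - P + 2 *\<^sub>R W"
    by (simp_all add: H_def flip: PQ, simp_all add: algebra_simps scaleR_2)
  ultimately show "norm (orthocenter A B C - (B + C - P)) = r"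
    "norm (orthocenter A B C - (C + A - P)) = r"
    "norm (orthocenter A B C - (A + B - P)) = r"
    using norm_W W0 assms by (simp_all add: norm_minus_commute)
qed

section \<open>Points on the line through \<open>P\<close> with direction \<open>D\<close>\<close>

lemma affine_combination_add:
  fixes P D :: "'a::real_vector"
  shows "(1 - u) *\<^sub>R P + u *\<^sub>R (P + D) = P + u *\<^sub>R D"
  by (simp add: algebra_simps)

lemma collinear_scaled:
  fixes P D :: "'a::real_vector"
  shows "collinear {P, P + (3/2) *\<^sub>R D, P + D, P + 3 *\<^sub>R D}"
proof -
  have "P = P + 0 *\<^sub>R D" "P + D = P + 1 *\<^sub>R D"
    by simp_all
  then show ?thesis
    unfolding collinear_alt by blast
qed

text \<open>Both ratios are 2: internally 1 to 1/2, externally 3 to 3/2, in units of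
  \<open>norm D\<close>.\<close>

lemma harmonic_range_scaled:
  fixes P D :: "'a::euclidean_space"
  assumes "D \<noteq> 0"
  shows "harmonic_range P (P + (3/2) *\<^sub>R D) (P + D) (P + 3 *\<^sub>R D)"
proof -
  let ?Q = "P + (3/2) *\<^sub>R D"
  have "collinear {P, ?Q, P + D, P + 3 *\<^sub>R D}"
    by (rule collinear_scaled)
  moreover have "divides_internally (P + D) P ?Q 2"
  proof -
    \<comment> \<open>Rescaling so that \<open>?Q\<close> gets parameter 1 divides by 3/2:
      \<open>P + D\<close> gets 2/3, and \<open>P + 3 *\<^sub>R D\<close> gets 2.\<close>
    have "P + D = (1 - 2/3) *\<^sub>R P + (2/3) *\<^sub>R ?Q"
      unfolding affine_combination_add by simp
    then have "P + D \<in> open_segment P ?Q"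
      unfolding in_segment using assms by (intro conjI exI[of _ "2/3"]) auto
    moreover have "?Q - (P + D) = (1/2) *\<^sub>R D"
      using scaleR_left_diff_distrib[of "3/2" 1 D] by simp
    ultimately show ?thesis
      using assms by (simp add: divides_internally_def)
  qed
  moreover have "divides_externally (P + 3 *\<^sub>R D) P ?Q 2"
  proof -
    have "P + 3 *\<^sub>R D = (1 - 2) *\<^sub>R P + 2 *\<^sub>R ?Q"
      unfolding affine_combination_add by simp
    then have "P + 3 *\<^sub>R D \<in> affine hull {P, ?Q}"
      unfolding affine_hull_2 by (intro CollectI exI[of _ "1 - 2"] exI[of _ 2]) simp
    \<comment> \<open>No point of a segment is farther from one endpoint than the other endpoint
      is.\<close>
    moreover have "P + 3 *\<^sub>R D \<notin> closed_segment P ?Q"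
    proof
      assume "P + 3 *\<^sub>R D \<in> closed_segment P ?Q"
      then have "norm (P + 3 *\<^sub>R D - P) \<le> norm (?Q - P)"
        using segment_bound(1) by blast
      then show False
        using assms by simp
    qed
    moreover have "?Q - (P + 3 *\<^sub>R D) = (-3/2) *\<^sub>R D"
      using scaleR_left_diff_distrib[of "3/2" 3 D] by simp
    ultimately show ?thesis
      using assms by (simp add: divides_externally_def)
  qed
  ultimately show ?thesis
    unfolding harmonic_range_def by blast
qed

section \<open>The reflected spheres, the sphere through the midpoints, and the harmonic
  range\<close>

theorem theorem1:
  fixes A M B N :: "nat \<Rightarrow> real ^ 'n"
    and S :: "nat \<Rightarrow> (real ^ 'n) set"
    and P G H H\<^sub>P Q\<^sub>P :: "real ^ 'n"
    and r :: real
  assumes noncollinear: "\<not> collinear {A 0, A 1, A 2}"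
    and G: "G = (1/3) *\<^sub>R (A 0 + A 1 + A 2)"
    and H: "H = orthocenter (A 0) (A 1) (A 2)"
    and M: "\<And>i j k. {i, j, k} = {0, 1, 2} \<Longrightarrow> M i = (1/2) *\<^sub>R (A j + A k)"
    and P: "norm (P - A 0) = r" "norm (P - A 1) = r" "norm (P - A 2) = r"
    and S: "\<And>i. i \<in> {0, 1, 2} \<Longrightarrow> S i = point_reflection (M i) ` sphere P r"
    and HP: "H\<^sub>P = A 0 + A 1 + A 2 - 2 *\<^sub>R P"
    and B: "\<And>i. i \<in> {0, 1, 2} \<Longrightarrow> B i = sphere_center (S i)"
    and QP: "Q\<^sub>P = (1/2) *\<^sub>R (A 0 + A 1 + A 2 - P)"
    and N: "\<And>i j k. {i, j, k} = {0, 1, 2} \<Longrightarrow> N i = (1/2) *\<^sub>R (B j + B k)"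
  shows "(H \<in> S 0 \<inter> S 1 \<inter> S 2 \<and> H\<^sub>P \<in> S 0 \<inter> S 1 \<inter> S 2) \<and>
    (\<forall>i\<in>{0, 1, 2}. point_reflection Q\<^sub>P (A i) = B i) \<and>
    (collinear {P, G, H\<^sub>P} \<and> between (P, H\<^sub>P) G \<and> 2 * norm (G - P) = norm (H\<^sub>P - G)) \<and>
    ({M 0, M 1, M 2, N 0, N 1, N 2} \<subseteq> sphere Q\<^sub>P (r / 2) \<and>
      (\<forall>X\<in>sphere P r. midpoint H\<^sub>P X \<in> sphere Q\<^sub>P (r / 2)) \<and>
      (\<forall>X\<in>sphere H\<^sub>P r. midpoint P X \<in> sphere Q\<^sub>P (r / 2))) \<and>
    (collinear {P, Q\<^sub>P, G, H\<^sub>P} \<and>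
      norm (G - P) = 2 * norm (Q\<^sub>P - G) \<and> norm (H\<^sub>P - P) = 2 * norm (Q\<^sub>P - H\<^sub>P) \<and>
      (P \<noteq> G \<longrightarrow> harmonic_range P Q\<^sub>P G H\<^sub>P \<and>
        norm (G - P) / norm (Q\<^sub>P - G) = norm (H\<^sub>P - P) / norm (Q\<^sub>P - H\<^sub>P) \<and>
        norm (H\<^sub>P - P) / norm (Q\<^sub>P - H\<^sub>P) = 2))"
proof (intro conjI)
  have perm: "{0, 1, 2} = {0, 1, 2::nat}" "{1, 2, 0} = {0, 1, 2::nat}" "{2, 0, 1} = {0, 1, 2::nat}"
    by auto
  have M012: "M 0 = (1/2) *\<^sub>R (A 1 + A 2)" "M 1 = (1/2) *\<^sub>R (A 2 + A 0)" "M 2 = (1/2) *\<^sub>R (A 0 + A 1)"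
    using M perm by blast+
  have N012: "N 0 = (1/2) *\<^sub>R (B 1 + B 2)" "N 1 = (1/2) *\<^sub>R (B 2 + B 0)" "N 2 = (1/2) *\<^sub>R (B 0 + B 1)"
    using N perm by blast+
  \<comment> \<open>Positivity lets \<open>sphere_center_sphere\<close> read off the centers
    \<open>B i\<close>; radius 0 would merge the vertices.\<close>
  have "r > 0"
  proof (rule ccontr)
    assume "\<not> r > 0"
    then have "r = 0"
      using P(1) norm_ge_zero[of "P - A 0"] by linarith
    with P have "A 0 = P" "A 1 = P" "A 2 = P"
      by auto
    with noncollinear show False
      by simp
  qed
  have S012: "S 0 = sphere (A 1 + A 2 - P) r" "S 1 = sphere (A 2 + A 0 - P) r"
    "S 2 = sphere (A 0 + A 1 - P) r"
    using S[of 0] S[of 1] S[of 2] by (simp_all add: M012 point_reflection_image_sphere del: One_nat_def)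
  have B012: "B 0 = A 1 + A 2 - P" "B 1 = A 2 + A 0 - P" "B 2 = A 0 + A 1 - P"
    using B[of 0] B[of 1] B[of 2] by (simp_all add: S012 sphere_center_sphere[OF \<open>r > 0\<close>] del: One_nat_def)
  show "H \<in> S 0 \<inter> S 1 \<inter> S 2"
    using orthocenter_dist[OF P] by (simp add: H S012 dist_norm norm_minus_commute del: One_nat_def)
  show "H\<^sub>P \<in> S 0 \<inter> S 1 \<inter> S 2"
  proof -
    have diffs: "A 1 + A 2 - P - H\<^sub>P = P - A 0" "A 2 + A 0 - P - H\<^sub>P = P - A 1" "A 0 + A 1 - P - H\<^sub>P = P - A 2"
      by (simp_all add: HP scaleR_2)
    show ?thesis
      unfolding S012 Int_iff mem_sphere dist_norm diffs using P by simp
  qed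
  show "\<forall>i\<in>{0, 1, 2}. point_reflection Q\<^sub>P (A i) = B i"
    by (auto simp: B012 point_reflection_def QP simp del: One_nat_def)
  \<comment> \<open>Each membership in the midpoint sphere is shown by writing the vector to
    \<open>Q\<^sub>P\<close> as half of a vector of length \<open>r\<close>.\<close>
  have sphere_half: "X \<in> sphere Q\<^sub>P (r / 2)" if "Q\<^sub>P - X = (1/2) *\<^sub>R Y" "norm Y = r" for X Y
    using that by (simp add: dist_norm)
  have "Q\<^sub>P - M 0 = (1/2) *\<^sub>R (A 0 - P)" "Q\<^sub>P - M 1 = (1/2) *\<^sub>R (A 1 - P)"
    "Q\<^sub>P - M 2 = (1/2) *\<^sub>R (A 2 - P)"
    by (simp_all add: QP M012 del: One_nat_def flip: scaleR_diff_right)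
  moreover have "Q\<^sub>P - N 0 = (1/2) *\<^sub>R (P - A 0)" "Q\<^sub>P - N 1 = (1/2) *\<^sub>R (P - A 1)"
    "Q\<^sub>P - N 2 = (1/2) *\<^sub>R (P - A 2)"
    by (simp_all add: QP N012 B012 del: One_nat_def flip: scaleR_diff_right)
  moreover have "norm (A 0 - P) = r" "norm (A 1 - P) = r" "norm (A 2 - P) = r"
    using P by (simp_all add: norm_minus_commute)
  ultimately show "{M 0, M 1, M 2, N 0, N 1, N 2} \<subseteq> sphere Q\<^sub>P (r / 2)"
    using sphere_half P by blast
  \<comment> \<open>Thus the homotheties of ratio 1/2 centered at \<open>H\<^sub>P\<close> and at
    \<open>P\<close> carry the spheres of radius \<open>r\<close> around \<open>P\<close> and around
    \<open>H\<^sub>P\<close>, respectively, to the midpoint sphere.\<close>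
  have Q_mid: "Q\<^sub>P = (1/2) *\<^sub>R (H\<^sub>P + P)"
    by (simp add: QP HP scaleR_2)
  show "\<forall>X\<in>sphere P r. midpoint H\<^sub>P X \<in> sphere Q\<^sub>P (r / 2)"
  proof
    fix X assume "X \<in> sphere P r"
    then show "midpoint H\<^sub>P X \<in> sphere Q\<^sub>P (r / 2)"
      by (intro sphere_half[of _ "P - X"]) (simp_all add: Q_mid midpoint_def dist_norm inverse_eq_divide flip: scaleR_diff_right)
  qed
  show "\<forall>X\<in>sphere H\<^sub>P r. midpoint P X \<in> sphere Q\<^sub>P (r / 2)"
  proof
    fix X assume "X \<in> sphere H\<^sub>P r"
    then show "midpoint P X \<in> sphere Q\<^sub>P (r / 2)"
      by (intro sphere_half[of _ "H\<^sub>P - X"]) (simp_all add: Q_mid midpoint_def dist_norm inverse_eq_divide flip: scaleR_diff_right)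
  qed
  define D where "D = G - P"
  have GD: "G = P + D"
    by (simp add: D_def)
  have "A 0 + A 1 + A 2 = 3 *\<^sub>R G"
    by (simp add: G)
  \<comment> \<open>This rewrites \<open>3 *\<^sub>R G - 2 *\<^sub>R P\<close> as
    \<open>P + 3 *\<^sub>R (G - P)\<close>.\<close>
  moreover have "3 *\<^sub>R P = P + 2 *\<^sub>R P"
    using scaleR_add_left[of 1 2 P] by simp
  ultimately have HD: "H\<^sub>P = P + 3 *\<^sub>R D"
    by (simp add: HP D_def scaleR_diff_right)
  have QD: "Q\<^sub>P = P + (3/2) *\<^sub>R D"
    using affine_combination_add[of "1/2" P "3 *\<^sub>R D"]
    unfolding Q_mid HD scaleR_add_right[of _ "P + 3 *\<^sub>R D" P] by (simp add: add.commute)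
  have GQ: "norm (Q\<^sub>P - G) = (1/2) * norm D"
  proof -
    have "Q\<^sub>P - G = (1/2) *\<^sub>R D"
      using scaleR_left_diff_distrib[of "3/2" 1 D] by (simp add: QD GD)
    then show ?thesis by simp
  qed
  have QH: "norm (Q\<^sub>P - H\<^sub>P) = (3/2) * norm D"
  proof -
    have "Q\<^sub>P - H\<^sub>P = (-3/2) *\<^sub>R D"
      using scaleR_left_diff_distrib[of "3/2" 3 D] by (simp add: QD HD)
    then show ?thesis by simp
  qed
  have HG: "H\<^sub>P - G = 2 *\<^sub>R D"
    using scaleR_left_diff_distrib[of 3 1 D] by (simp add: HD GD)
  show "collinear {P, Q\<^sub>P, G, H\<^sub>P}"
    unfolding QD GD HD by (rule collinear_scaled)
  then show "collinear {P, G, H\<^sub>P}"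
    by (rule collinear_subset) auto
  show "between (P, H\<^sub>P) G"
  proof -
    have "G = (1 - 1/3) *\<^sub>R P + (1/3) *\<^sub>R H\<^sub>P"
      unfolding HD GD affine_combination_add by simp
    then show ?thesis
      unfolding between_mem_segment in_segment by (intro exI[of _ "1/3"]) auto
  qed
  show "2 * norm (G - P) = norm (H\<^sub>P - G)"
    by (simp add: HG flip: D_def)
  show GP: "norm (G - P) = 2 * norm (Q\<^sub>P - G)"
    by (simp add: GQ flip: D_def)
  show HPP: "norm (H\<^sub>P - P) = 2 * norm (Q\<^sub>P - H\<^sub>P)"
    \<comment> \<open>\<open>QH\<close> is applied first, while \<open>H\<^sub>P\<close> is still
      folded; \<open>HD\<close> would expand it on both sides.\<close>
    by (simp add: QH) (simp add: HD)
  \<comment> \<open>If \<open>P = G\<close>, all four points coincide and the quotients become 0/0;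
    the two product equations shown before cover that case as well.\<close>
  show "P \<noteq> G \<longrightarrow> harmonic_range P Q\<^sub>P G H\<^sub>P \<and>
        norm (G - P) / norm (Q\<^sub>P - G) = norm (H\<^sub>P - P) / norm (Q\<^sub>P - H\<^sub>P) \<and>
        norm (H\<^sub>P - P) / norm (Q\<^sub>P - H\<^sub>P) = 2"
  proof
    assume "P \<noteq> G"
    then have "D \<noteq> 0"
      by (simp add: D_def)
    then show "harmonic_range P Q\<^sub>P G H\<^sub>P \<and>
        norm (G - P) / norm (Q\<^sub>P - G) = norm (H\<^sub>P - P) / norm (Q\<^sub>P - H\<^sub>P) \<and>
        norm (H\<^sub>P - P) / norm (Q\<^sub>P - H\<^sub>P) = 2"
      using harmonic_range_scaled[of D P] by (simp add: GP HPP GQ QH) (simp add: GD HD QD)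
  qed
qed

end
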